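(* Let $E(H,K)\equiv e\to H\xrightarrow{i} G\xrightarrow{\beta} K\to e$ be a central extension of multiplicative Lie algebras, where $K$ is a finite multiplicative Lie algebra. If $K$ is perfect and $\tilde M(K)=e$, then every pair $(\alpha,\eta)\in\mathrm{Aut}(H)\times\mathrm{Aut}(K)$ is inducible.
   Context: A multiplicative Lie algebra is a triple $(G,\cdot,\star)$ where $(G,\cdot)$ is a (possibly non-abelian) group with identity $e$ and $\star$ is a binary operation such that for all $x,y,z\in G$, writing ${}^zx=zxz^{-1}$: $x\star x=e$; $x\star(yz)=(x\star y)\cdot{}^y(x\star z)$; $(xy)\star z={}^x(y\star z)\cdot(x\star z)$; $((x\star y)\star{}^yz)((y\star z)\star{}^zx)((z\star x)\star{}^xy)=e$; ${}^z(x\star y)={}^zx\star{}^zy$. Homomorphisms preserve both operations, and $\mathrm{Aut}$ denotes the group of automorphisms of a multiplicative Lie algebra. A central extension $E(H,K)\equiv e\to H\xrightarrow{i} G\xrightarrow{\beta}K\to e$ is a short exact sequence of multiplicative Lie algebras in which $H$ (identified with $i(H)=\ker\beta$) is contained in $Z(G)\cap LZ(G)$, where $Z(G)$ is the group center and $LZ(G)=\{x\in G: x\star y=e\ \forall y\in G\}$; in particular $\star$ is trivial on $H$. A transversal is a map $t:K\to G$ with $\beta(t(x))=x$ for all $x\in K$ and $t(e)=e$. A pair $(\alpha,\eta)\in\mathrm{Aut}(H)\times\mathrm{Aut}(K)$ is inducible if there is $\phi\in\mathrm{Aut}(G)$ with $\phi(H)=H$, $\phi|_H=\alpha$ and $\beta(\phi(t(x)))=\eta(x)$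 for all $x\in K$ (independent of the transversal $t$). For ideals $A,B$ of a multiplicative Lie algebra, $[A,B]$ is the subgroup generated by the commutators $[a,b]$ and $A\star B$ the subgroup generated by the elements $a\star b$, $a\in A$, $b\in B$. $K$ is perfect if $K=[K,K](K\star K)$. A free presentation of $K$ is a short exact sequence $e\to R\to F\to K\to e$ of multiplicative Lie algebras with $F$ a free multiplicative Lie algebra; the Schur multiplier of $K$ is $\tilde M(K)=\dfrac{([F,F](F\star F))\cap R}{[R,F](R\star F)}$ (independent, up to isomorphism, of the free presentation). *)

theory Defs
  imports "HOL-Algebra.Bij" "HOL-Algebra.Generated_Groups"
begin

section \<open>Multiplicative Lie algebras\<close>

record 'a mla = "'a monoid" +
  star :: "['a, 'a] \<Rightarrow> 'a" (infixl \<open>\<star>\<index>\<close> 70)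

text \<open>\<open>conj_by L z x\<close> is the left conjugate written with \<open>z\<close> as a left superscript of \<open>x\<close>.\<close>

definition conj_by :: "('a, 'm) mla_scheme \<Rightarrow> 'a \<Rightarrow> 'a \<Rightarrow> 'a" where
  "conj_by L z x = z \<otimes>\<^bsub>L\<^esub> x \<otimes>\<^bsub>L\<^esub> inv\<^bsub>L\<^esub> z"

locale mult_lie_algebra = group L for L :: "('a, 'm) mla_scheme" (structure) +
  assumes star_closed [intro, simp]:
      "\<lbrakk>x \<in> carrier L; y \<in> carrier L\<rbrakk> \<Longrightarrow> x \<star> y \<in> carrier L"
    and star_self: "x \<in> carrier L \<Longrightarrow> x \<star> x = \<one>"
    and star_mult_right:
      "\<lbrakk>x \<in> carrier L; y \<in> carrier L; z \<in> carrier L\<rbrakk>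
        \<Longrightarrow> x \<star> (y \<otimes> z) = (x \<star> y) \<otimes> conj_by L y (x \<star> z)"
    and star_mult_left:
      "\<lbrakk>x \<in> carrier L; y \<in> carrier L; z \<in> carrier L\<rbrakk>
        \<Longrightarrow> (x \<otimes> y) \<star> z = conj_by L x (y \<star> z) \<otimes> (x \<star> z)"
    and star_jacobi:
      "\<lbrakk>x \<in> carrier L; y \<in> carrier L; z \<in> carrier L\<rbrakk>
        \<Longrightarrow> ((x \<star> y) \<star> conj_by L y z) \<otimes> ((y \<star> z) \<star> conj_by L z x)
              \<otimes> ((z \<star> x) \<star> conj_by L x y) = \<one>"
    and conj_by_star:
      "\<lbrakk>x \<in> carrier L; y \<in> carrier L; z \<in> carrier L\<rbrakk>
        \<Longrightarrow> conj_by L z (x \<star> y) = conj_by L z x \<star> conj_by L z y"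

definition mla_hom :: "('a, 'm) mla_scheme \<Rightarrow> ('b, 'n) mla_scheme \<Rightarrow> ('a \<Rightarrow> 'b) set" where
  "mla_hom L M = {h \<in> hom L M.
     \<forall>x \<in> carrier L. \<forall>y \<in> carrier L. h (x \<star>\<^bsub>L\<^esub> y) = h x \<star>\<^bsub>M\<^esub> h y}"

definition mla_iso :: "('a, 'm) mla_scheme \<Rightarrow> ('b, 'n) mla_scheme \<Rightarrow> ('a \<Rightarrow> 'b) set" where
  "mla_iso L M = {h \<in> mla_hom L M. bij_betw h (carrier L) (carrier M)}"

text \<open>As in \<^const>\<open>auto\<close>, automorphisms are extensional functions on the carrier.\<close>

definition mla_auto :: "('a, 'm) mla_scheme \<Rightarrow> ('a \<Rightarrow> 'a) set" where
  "mla_auto L = mla_hom L L \<inter> Bij (carrier L)"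

definition group_center :: "('a, 'm) mla_scheme \<Rightarrow> 'a set" where
  "group_center L = {x \<in> carrier L. \<forall>y \<in> carrier L. x \<otimes>\<^bsub>L\<^esub> y = y \<otimes>\<^bsub>L\<^esub> x}"

definition lie_center :: "('a, 'm) mla_scheme \<Rightarrow> 'a set" where
  "lie_center L = {x \<in> carrier L. \<forall>y \<in> carrier L. x \<star>\<^bsub>L\<^esub> y = \<one>\<^bsub>L\<^esub>}"

definition commutator_subgroup :: "('a, 'm) mla_scheme \<Rightarrow> 'a set \<Rightarrow> 'a set \<Rightarrow> 'a set" where
  "commutator_subgroup L A B =
     generate L {a \<otimes>\<^bsub>L\<^esub> b \<otimes>\<^bsub>L\<^esub> inv\<^bsub>L\<^esub> a \<otimes>\<^bsub>L\<^esub> inv\<^bsub>L\<^esub> b | a b. a \<in> A \<and> b \<in> B}"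

definition star_subgroup :: "('a, 'm) mla_scheme \<Rightarrow> 'a set \<Rightarrow> 'a set \<Rightarrow> 'a set" where
  "star_subgroup L A B = generate L {a \<star>\<^bsub>L\<^esub> b | a b. a \<in> A \<and> b \<in> B}"

text \<open>The product \<open>[A,B](A \<star> B)\<close>.\<close>

definition lie_commutator :: "('a, 'm) mla_scheme \<Rightarrow> 'a set \<Rightarrow> 'a set \<Rightarrow> 'a set" where
  "lie_commutator L A B = commutator_subgroup L A B <#>\<^bsub>L\<^esub> star_subgroup L A B"

definition perfect_mla :: "('a, 'm) mla_scheme \<Rightarrow> bool" where
  "perfect_mla L \<longleftrightarrow> carrier L = lie_commutator L (carrier L) (carrier L)"

definition mla_quotient :: "('a, 'm) mla_scheme \<Rightarrow> 'a set \<Rightarrow> 'a set mla" where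
  "mla_quotient L I =
     \<lparr>carrier = rcosets\<^bsub>L\<^esub> I, monoid.mult = set_mult L, one = I,
      star = \<lambda>A B. \<Union>a \<in> A. \<Union>b \<in> B. I #>\<^bsub>L\<^esub> (a \<star>\<^bsub>L\<^esub> b)\<rparr>"


section \<open>Extensions\<close>

definition mla_short_exact ::
  "('h, 'm) mla_scheme \<Rightarrow> ('h \<Rightarrow> 'g) \<Rightarrow> ('g, 'n) mla_scheme \<Rightarrow> ('g \<Rightarrow> 'k) \<Rightarrow> ('k, 'p) mla_scheme \<Rightarrow> bool"
  where
  "mla_short_exact H i G \<beta> K \<longleftrightarrow>
     mult_lie_algebra H \<and> mult_lie_algebra G \<and> mult_lie_algebra K \<and>
     i \<in> mla_hom H G \<and> inj_on i (carrier H) \<and>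
     \<beta> \<in> mla_hom G K \<and> \<beta> ` carrier G = carrier K \<and>
     i ` carrier H = kernel G K \<beta>"

definition central_extension ::
  "('h, 'm) mla_scheme \<Rightarrow> ('h \<Rightarrow> 'g) \<Rightarrow> ('g, 'n) mla_scheme \<Rightarrow> ('g \<Rightarrow> 'k) \<Rightarrow> ('k, 'p) mla_scheme \<Rightarrow> bool"
  where
  "central_extension H i G \<beta> K \<longleftrightarrow>
     mla_short_exact H i G \<beta> K \<and> i ` carrier H \<subseteq> group_center G \<inter> lie_center G"

definition transversals ::
  "('g, 'n) mla_scheme \<Rightarrow> ('g \<Rightarrow> 'k) \<Rightarrow> ('k, 'p) mla_scheme \<Rightarrow> ('k \<Rightarrow> 'g) set" where
  "transversals G \<beta> K =
     {t \<in> carrier K \<rightarrow> carrier G. (\<forall>x \<in> carrier K. \<beta> (t x) = x) \<and> t \<one>\<^bsub>K\<^esub> = \<one>\<^bsub>G\<^esub>}"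

text \<open>
  \<open>H\<close> is identified with its image under \<open>i\<close>, so that \<open>\<phi>\<close> restricting to \<open>\<alpha>\<close> on \<open>H\<close> reads
  \<open>\<phi> \<circ> i = i \<circ> \<alpha>\<close>.  The induced map on \<open>K\<close> does not depend on the transversal; the condition is
  required for all of them.
\<close>

definition inducible ::
  "('h, 'm) mla_scheme \<Rightarrow> ('h \<Rightarrow> 'g) \<Rightarrow> ('g, 'n) mla_scheme \<Rightarrow> ('g \<Rightarrow> 'k) \<Rightarrow> ('k, 'p) mla_scheme
    \<Rightarrow> ('h \<Rightarrow> 'h) \<Rightarrow> ('k \<Rightarrow> 'k) \<Rightarrow> bool" where
  "inducible H i G \<beta> K \<alpha> \<eta> \<longleftrightarrow>
     (\<exists>\<phi> \<in> mla_auto G.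
        \<phi> ` (i ` carrier H) = i ` carrier H \<and>
        (\<forall>h \<in> carrier H. \<phi> (i h) = i (\<alpha> h)) \<and>
        (\<forall>t \<in> transversals G \<beta> K. \<forall>x \<in> carrier K. \<beta> (\<phi> (t x)) = \<eta> x))"


section \<open>Free multiplicative Lie algebras\<close>

text \<open>
  The free multiplicative Lie algebra on a set \<open>X\<close> of generators is the algebra of terms over \<open>X\<close>
  modulo the congruence generated by the defining identities.
\<close>

datatype 'x mla_term =
    Gen 'x
  | One
  | Mul "'x mla_term" "'x mla_term"
  | Inv "'x mla_term"
  | Star "'x mla_term" "'x mla_term"

abbreviation Conj :: "'x mla_term \<Rightarrow> 'x mla_term \<Rightarrow> 'x mla_term" where
  "Conj z x \<equiv> Mul (Mul z x) (Inv z)"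

inductive mla_eq :: "'x mla_term \<Rightarrow> 'x mla_term \<Rightarrow> bool" where
  refl: "mla_eq s s"
| sym: "mla_eq s t \<Longrightarrow> mla_eq t s"
| trans: "mla_eq s t \<Longrightarrow> mla_eq t u \<Longrightarrow> mla_eq s u"
| cong_Mul: "mla_eq s s' \<Longrightarrow> mla_eq t t' \<Longrightarrow> mla_eq (Mul s t) (Mul s' t')"
| cong_Inv: "mla_eq s s' \<Longrightarrow> mla_eq (Inv s) (Inv s')"
| cong_Star: "mla_eq s s' \<Longrightarrow> mla_eq t t' \<Longrightarrow> mla_eq (Star s t) (Star s' t')"
| assoc: "mla_eq (Mul (Mul s t) u) (Mul s (Mul t u))"
| one_left: "mla_eq (Mul One s) s"
| inv_left: "mla_eq (Mul (Inv s) s) One"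
| star_self: "mla_eq (Star s s) One"
| star_mult_right: "mla_eq (Star s (Mul t u)) (Mul (Star s t) (Conj t (Star s u)))"
| star_mult_left: "mla_eq (Star (Mul s t) u) (Mul (Conj s (Star t u)) (Star s u))"
| star_jacobi:
    "mla_eq (Mul (Mul (Star (Star s t) (Conj t u)) (Star (Star t u) (Conj u s)))
              (Star (Star u s) (Conj s t))) One"
| conj_by_star: "mla_eq (Conj u (Star s t)) (Star (Conj u s) (Conj u t))"

definition mla_terms :: "'x set \<Rightarrow> 'x mla_term set" where
  "mla_terms X = {t. set_mla_term t \<subseteq> X}"

definition mla_rel :: "'x set \<Rightarrow> ('x mla_term \<times> 'x mla_term) set" where
  "mla_rel X = {(s, t). s \<in> mla_terms X \<and> t \<in> mla_terms X \<and> mla_eq s t}"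

definition mla_class :: "'x set \<Rightarrow> 'x mla_term \<Rightarrow> 'x mla_term set" where
  "mla_class X t = mla_rel X `` {t}"

definition free_mla :: "'x set \<Rightarrow> 'x mla_term set mla" where
  "free_mla X =
     \<lparr>carrier = mla_terms X // mla_rel X,
      monoid.mult = \<lambda>A B. \<Union>s \<in> A. \<Union>t \<in> B. mla_class X (Mul s t),
      one = mla_class X One,
      star = \<lambda>A B. \<Union>s \<in> A. \<Union>t \<in> B. mla_class X (Star s t)\<rparr>"

definition free_on :: "('f, 'm) mla_scheme \<Rightarrow> 'f set \<Rightarrow> bool" where
  "free_on F B \<longleftrightarrow> mult_lie_algebra F \<and> B \<subseteq> carrier F \<and>
     (\<exists>\<theta> \<in> mla_iso (free_mla B) F. \<forall>b \<in> B. \<theta> (mla_class B (Gen b)) = b)"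

definition is_free_mla :: "('f, 'm) mla_scheme \<Rightarrow> bool" where
  "is_free_mla F \<longleftrightarrow> (\<exists>B. free_on F B)"

definition free_presentation ::
  "('r, 'm) mla_scheme \<Rightarrow> ('r \<Rightarrow> 'f) \<Rightarrow> ('f, 'n) mla_scheme \<Rightarrow> ('f \<Rightarrow> 'k) \<Rightarrow> ('k, 'p) mla_scheme \<Rightarrow> bool"
  where
  "free_presentation R j F \<pi> K \<longleftrightarrow> mla_short_exact R j F \<pi> K \<and> is_free_mla F"

text \<open>
  The Schur multiplier computed from a presentation with relations \<open>R\<close> embedded in \<open>F\<close> by \<open>j\<close>:
  \<open>(([F,F](F \<star> F)) \<inter> R) / ([R,F](R \<star> F))\<close>.
\<close>

definition schur_multiplier ::
  "('r, 'm) mla_scheme \<Rightarrow> ('r \<Rightarrow> 'f) \<Rightarrow> ('f, 'n) mla_scheme \<Rightarrow> 'f set mla" where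
  "schur_multiplier R j F =
     (let N = j ` carrier R in
      mla_quotient
        (F\<lparr>carrier := lie_commutator F (carrier F) (carrier F) \<inter> N\<rparr>)
        (lie_commutator F N (carrier F)))"


subsection \<open>Universal property and existence of free presentations\<close>

lemma mla_terms_simps [simp]:
  "Gen x \<in> mla_terms X \<longleftrightarrow> x \<in> X"
  "One \<in> mla_terms X"
  "Mul s t \<in> mla_terms X \<longleftrightarrow> s \<in> mla_terms X \<and> t \<in> mla_terms X"
  "Inv s \<in> mla_terms X \<longleftrightarrow> s \<in> mla_terms X"
  "Star s t \<in> mla_terms X \<longleftrightarrow> s \<in> mla_terms X \<and> t \<in> mla_terms X"
  by (auto simp: mla_terms_def)

lemma equiv_mla_rel: "equiv (mla_terms X) (mla_rel X)"
  by (rule equivI)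
    (auto simp: mla_rel_def refl_on_def intro!: symI transI intro: mla_eq.refl mla_eq.sym mla_eq.trans)

lemma mla_class_eqI: "mla_eq s t \<Longrightarrow> s \<in> mla_terms X \<Longrightarrow> t \<in> mla_terms X \<Longrightarrow> mla_class X s = mla_class X t"
  unfolding mla_class_def
  by (rule equiv_class_eq[OF equiv_mla_rel]) (simp add: mla_rel_def)

lemma mla_class_in: "t \<in> mla_terms X \<Longrightarrow> mla_class X t \<in> carrier (free_mla X)"
  by (simp add: free_mla_def mla_class_def quotientI)

lemma free_mla_carrierE:
  assumes "A \<in> carrier (free_mla X)"
  obtains t where "t \<in> mla_terms X" "A = mla_class X t"
  using assms by (auto simp: free_mla_def mla_class_def elim: quotientE)

lemma free_mla_one: "\<one>\<^bsub>free_mla X\<^esub> = mla_class X One"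
  by (simp add: free_mla_def)

lemma free_mla_mult:
  assumes "s \<in> mla_terms X" "t \<in> mla_terms X"
  shows "mla_class X s \<otimes>\<^bsub>free_mla X\<^esub> mla_class X t = mla_class X (Mul s t)"
proof -
  have "congruent2 (mla_rel X) (mla_rel X) (\<lambda>s t. mla_class X (Mul s t))"
    by (rule congruent2I', rule mla_class_eqI) (auto simp: mla_rel_def intro: mla_eq.cong_Mul)
  from UN_equiv_class2[OF equiv_mla_rel equiv_mla_rel this assms] show ?thesis
    by (simp add: free_mla_def mla_class_def)
qed

lemma free_mla_star:
  assumes "s \<in> mla_terms X" "t \<in> mla_terms X"
  shows "mla_class X s \<star>\<^bsub>free_mla X\<^esub> mla_class X t = mla_class X (Star s t)"
proof -
  have "congruent2 (mla_rel X) (mla_rel X) (\<lambda>s t. mla_class X (Star s t))"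
    by (rule congruent2I', rule mla_class_eqI) (auto simp: mla_rel_def intro: mla_eq.cong_Star)
  from UN_equiv_class2[OF equiv_mla_rel equiv_mla_rel this assms] show ?thesis
    by (simp add: free_mla_def mla_class_def)
qed

lemma group_free_mla: "group (free_mla X)"
proof (rule groupI)
  fix A assume "A \<in> carrier (free_mla X)"
  then obtain s where s: "s \<in> mla_terms X" "A = mla_class X s" by (rule free_mla_carrierE)
  show "\<one>\<^bsub>free_mla X\<^esub> \<otimes>\<^bsub>free_mla X\<^esub> A = A"
    using s by (simp add: free_mla_one free_mla_mult mla_class_eqI mla_eq.one_left)
  show "\<exists>B \<in> carrier (free_mla X). B \<otimes>\<^bsub>free_mla X\<^esub> A = \<one>\<^bsub>free_mla X\<^esub>"
    by (rule bexI[of _ "mla_class X (Inv s)"])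
      (use s in \<open>simp_all add: free_mla_one free_mla_mult mla_class_in mla_class_eqI mla_eq.inv_left\<close>)
next
  fix A B C
  assume "A \<in> carrier (free_mla X)" "B \<in> carrier (free_mla X)" "C \<in> carrier (free_mla X)"
  then show "A \<otimes>\<^bsub>free_mla X\<^esub> B \<otimes>\<^bsub>free_mla X\<^esub> C = A \<otimes>\<^bsub>free_mla X\<^esub> (B \<otimes>\<^bsub>free_mla X\<^esub> C)"
    by (elim free_mla_carrierE) (simp add: free_mla_mult mla_class_eqI mla_eq.assoc)
qed (auto elim!: free_mla_carrierE simp: free_mla_mult free_mla_one mla_class_in)

lemma free_mla_inv:
  assumes "s \<in> mla_terms X"
  shows "inv\<^bsub>free_mla X\<^esub> (mla_class X s) = mla_class X (Inv s)"
  using assms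
  by (intro group.inv_equality[OF group_free_mla])
    (simp_all add: free_mla_one free_mla_mult mla_class_in mla_class_eqI mla_eq.inv_left)

lemma mult_lie_algebra_free_mla: "mult_lie_algebra (free_mla X)"
proof (intro mult_lie_algebra.intro group_free_mla mult_lie_algebra_axioms.intro)
  note ops = free_mla_one free_mla_mult free_mla_star free_mla_inv conj_by_def
  fix A assume A: "A \<in> carrier (free_mla X)"
  then show "A \<star>\<^bsub>free_mla X\<^esub> A = \<one>\<^bsub>free_mla X\<^esub>"
    by (elim free_mla_carrierE) (simp add: ops mla_class_eqI mla_eq.star_self)
  fix B assume B: "B \<in> carrier (free_mla X)"
  show "A \<star>\<^bsub>free_mla X\<^esub> B \<in> carrier (free_mla X)"
    using A B by (elim free_mla_carrierE) (simp add: ops mla_class_in)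
  fix C assume C: "C \<in> carrier (free_mla X)"
  show "A \<star>\<^bsub>free_mla X\<^esub> (B \<otimes>\<^bsub>free_mla X\<^esub> C) =
      (A \<star>\<^bsub>free_mla X\<^esub> B) \<otimes>\<^bsub>free_mla X\<^esub> conj_by (free_mla X) B (A \<star>\<^bsub>free_mla X\<^esub> C)"
    using A B C by (elim free_mla_carrierE) (simp add: ops mla_class_eqI mla_eq.star_mult_right)
  show "(A \<otimes>\<^bsub>free_mla X\<^esub> B) \<star>\<^bsub>free_mla X\<^esub> C =
      conj_by (free_mla X) A (B \<star>\<^bsub>free_mla X\<^esub> C) \<otimes>\<^bsub>free_mla X\<^esub> (A \<star>\<^bsub>free_mla X\<^esub> C)"
    using A B C by (elim free_mla_carrierE) (simp add: ops mla_class_eqI mla_eq.star_mult_left)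
  show "((A \<star>\<^bsub>free_mla X\<^esub> B) \<star>\<^bsub>free_mla X\<^esub> conj_by (free_mla X) B C) \<otimes>\<^bsub>free_mla X\<^esub>
        ((B \<star>\<^bsub>free_mla X\<^esub> C) \<star>\<^bsub>free_mla X\<^esub> conj_by (free_mla X) C A) \<otimes>\<^bsub>free_mla X\<^esub>
        ((C \<star>\<^bsub>free_mla X\<^esub> A) \<star>\<^bsub>free_mla X\<^esub> conj_by (free_mla X) A B) = \<one>\<^bsub>free_mla X\<^esub>"
    using A B C by (elim free_mla_carrierE) (simp add: ops mla_class_eqI mla_eq.star_jacobi)
  show "conj_by (free_mla X) C (A \<star>\<^bsub>free_mla X\<^esub> B) =
      conj_by (free_mla X) C A \<star>\<^bsub>free_mla X\<^esub> conj_by (free_mla X) C B"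
    using A B C by (elim free_mla_carrierE) (simp add: ops mla_class_eqI mla_eq.conj_by_star)
qed

primrec mla_eval :: "('a, 'm) mla_scheme \<Rightarrow> ('x \<Rightarrow> 'a) \<Rightarrow> 'x mla_term \<Rightarrow> 'a" where
  "mla_eval L f (Gen x) = f x"
| "mla_eval L f One = \<one>\<^bsub>L\<^esub>"
| "mla_eval L f (Mul s t) = mla_eval L f s \<otimes>\<^bsub>L\<^esub> mla_eval L f t"
| "mla_eval L f (Inv s) = inv\<^bsub>L\<^esub> (mla_eval L f s)"
| "mla_eval L f (Star s t) = mla_eval L f s \<star>\<^bsub>L\<^esub> mla_eval L f t"

context mult_lie_algebra
begin

lemma mla_eval_closed:
  assumes "range f \<subseteq> carrier L"
  shows "mla_eval L f t \<in> carrier L"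
  using assms by (induction t) auto

lemma mla_eval_eq:
  assumes "mla_eq s t" "range f \<subseteq> carrier L"
  shows "mla_eval L f s = mla_eval L f t"
  using assms
proof (induction rule: mla_eq.induct)
  case (star_mult_right s t u)
  then show ?case using star_mult_right by (simp add: mla_eval_closed mult_lie_algebra.star_mult_right[OF mult_lie_algebra_axioms] conj_by_def)
next
  case (star_mult_left s t u)
  then show ?case by (simp add: mla_eval_closed mult_lie_algebra.star_mult_left[OF mult_lie_algebra_axioms] conj_by_def)
next
  case (star_self s)
  then show ?case by (simp add: mla_eval_closed mult_lie_algebra.star_self[OF mult_lie_algebra_axioms])
next
  case (star_jacobi s t u)
  then show ?case
    using mult_lie_algebra.star_jacobi[OF mult_lie_algebra_axioms,
        of "mla_eval L f s" "mla_eval L f t" "mla_eval L f u"]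
    by (simp add: mla_eval_closed conj_by_def)
next
  case (conj_by_star u s t)
  then show ?case
    using mult_lie_algebra.conj_by_star[OF mult_lie_algebra_axioms,
        of "mla_eval L f s" "mla_eval L f t" "mla_eval L f u"]
    by (simp add: mla_eval_closed conj_by_def)
qed (auto simp: mla_eval_closed m_assoc)

theorem free_mla_universal:
  assumes "f \<in> X \<rightarrow> carrier L"
  shows "\<exists>h \<in> mla_hom (free_mla X) L. \<forall>x \<in> X. h (mla_class X (Gen x)) = f x"
proof -
  define g where "g x = (if x \<in> X then f x else \<one>)" for x
  have g: "range g \<subseteq> carrier L"
    using assms by (auto simp: g_def)
  define h where "h A = mla_eval L g (SOME t. t \<in> A)" for A
  have h: "h (mla_class X t) = mla_eval L g t" if "t \<in> mla_terms X" for t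
  proof -
    have "t \<in> mla_class X t"
      using that by (simp add: mla_class_def mla_rel_def mla_eq.refl)
    then have "(SOME u. u \<in> mla_class X t) \<in> mla_class X t"
      by (rule someI)
    moreover have "mla_eq t u" if "u \<in> mla_class X t" for u
      using that by (simp add: mla_class_def mla_rel_def)
    ultimately have "mla_eq t (SOME u. u \<in> mla_class X t)"
      by blast
    then show ?thesis
      unfolding h_def using mla_eval_eq[OF _ g] by metis
  qed
  have "h \<in> mla_hom (free_mla X) L"
    by (auto simp: mla_hom_def hom_def h free_mla_mult free_mla_star mla_eval_closed[OF g]
        elim!: free_mla_carrierE)
  moreover have "\<forall>x \<in> X. h (mla_class X (Gen x)) = f x"
    by (simp add: h g_def)
  ultimately show ?thesis by blast
qed

theorem free_mla_universal_unique:
  assumes "h \<in> mla_hom (free_mla X) L" "h' \<in> mla_hom (free_mla X) L"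
    and eq: "\<And>x. x \<in> X \<Longrightarrow> h (mla_class X (Gen x)) = h' (mla_class X (Gen x))"
    and A: "A \<in> carrier (free_mla X)"
  shows "h A = h' A"
proof -
  interpret h: group_hom "free_mla X" L h
    using assms group_free_mla by (simp add: group_hom_def group_hom_axioms_def mla_hom_def is_group)
  interpret h': group_hom "free_mla X" L h'
    using assms group_free_mla by (simp add: group_hom_def group_hom_axioms_def mla_hom_def is_group)
  have star: "k (mla_class X (Star s t)) = k (mla_class X s) \<star> k (mla_class X t)"
    if "k \<in> mla_hom (free_mla X) L" "s \<in> mla_terms X" "t \<in> mla_terms X" for k s t
    using that by (auto simp: mla_hom_def mla_class_in simp flip: free_mla_star)
  have "h (mla_class X t) = h' (mla_class X t)" if "t \<in> mla_terms X" for t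
    using that
  proof (induction t)
    case (Gen x)
    then show ?case by (simp add: eq)
  next
    case One
    then show ?case using h.hom_one h'.hom_one by (simp add: free_mla_one)
  next
    case (Mul s t)
    then show ?case by (simp add: mla_class_in flip: free_mla_mult)
  next
    case (Inv s)
    then show ?case by (simp add: mla_class_in flip: free_mla_inv)
  next
    case (Star s t)
    then show ?case using star[OF assms(1)] star[OF assms(2)] by simp
  qed
  with A show ?thesis by (elim free_mla_carrierE) simp
qed

end

lemma mla_hom_compose:
  assumes "f \<in> mla_hom L M" "g \<in> mla_hom M N"
  shows "(\<lambda>x. g (f x)) \<in> mla_hom L N"
  using assms by (auto simp: mla_hom_def hom_def Pi_iff)

lemma mla_hom_id: "(\<lambda>x. x) \<in> mla_hom L L"
  by (auto simp: mla_hom_def hom_def)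

lemma inj_on_generators: "inj_on (\<lambda>x. mla_class X (Gen x)) X"
proof -
  define S :: "'a set mla" where
    "S = \<lparr>carrier = UNIV, monoid.mult = \<lambda>A B. (A - B) \<union> (B - A), one = {}, star = \<lambda>A B. {}\<rparr>"
  have "group S"
    by (rule groupI) (auto simp: S_def)
  moreover from this have "conj_by S z \<one>\<^bsub>S\<^esub> = \<one>\<^bsub>S\<^esub>" for z
  proof -
    have "z \<in> carrier S" by (simp add: S_def)
    with \<open>group S\<close> show ?thesis
      by (simp add: conj_by_def group.is_monoid monoid.r_one group.r_inv)
  qed
  then have "conj_by S z {} = {}" for z
    by (simp add: S_def)
  ultimately have "mult_lie_algebra S"
    by (simp add: mult_lie_algebra_def mult_lie_algebra_axioms_def) (simp add: S_def)
  then obtain h where "\<forall>x \<in> X. h (mla_class X (Gen x)) = {x}"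
    using mult_lie_algebra.free_mla_universal[of S "\<lambda>x. {x}" X] by (auto simp: S_def)
  then show ?thesis
    by (intro inj_onI) (metis singleton_inject)
qed

theorem free_on_free_mla: "free_on (free_mla X) ((\<lambda>x. mla_class X (Gen x)) ` X)"
proof -
  let ?g = "\<lambda>x. mla_class X (Gen x)"
  let ?B = "?g ` X"
  interpret F: mult_lie_algebra "free_mla X" by (rule mult_lie_algebra_free_mla)
  interpret E: mult_lie_algebra "free_mla ?B" by (rule mult_lie_algebra_free_mla)
  have B: "?B \<subseteq> carrier (free_mla X)"
    by (auto intro: mla_class_in)
  obtain \<theta> where \<theta>: "\<theta> \<in> mla_hom (free_mla ?B) (free_mla X)"
      "\<forall>b \<in> ?B. \<theta> (mla_class ?B (Gen b)) = b"
    using F.free_mla_universal[of "\<lambda>b. b" ?B] B by fast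
  obtain \<psi> where \<psi>: "\<psi> \<in> mla_hom (free_mla X) (free_mla ?B)"
      "\<forall>x \<in> X. \<psi> (?g x) = mla_class ?B (Gen (?g x))"
    using E.free_mla_universal[of "\<lambda>x. mla_class ?B (Gen (?g x))" X]
    by (smt (verit) PiE Pi_I image_eqI mla_class_in mla_terms_simps(1))
  have "\<theta> (\<psi> A) = A" if "A \<in> carrier (free_mla X)" for A
    using F.free_mla_universal_unique[OF mla_hom_compose[OF \<psi>(1) \<theta>(1)] mla_hom_id _ that] \<theta>(2) \<psi>(2)
    by auto
  moreover have "\<psi> (\<theta> A) = A" if "A \<in> carrier (free_mla ?B)" for A
    using E.free_mla_universal_unique[OF mla_hom_compose[OF \<theta>(1) \<psi>(1)] mla_hom_id _ that] \<theta>(2) \<psi>(2)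
    by auto
  ultimately have "bij_betw \<theta> (carrier (free_mla ?B)) (carrier (free_mla X))"
    using \<theta>(1) \<psi>(1) by (intro bij_betw_byWitness[where f' = \<psi>]) (auto simp: mla_hom_def hom_def)
  with \<theta> B show ?thesis
    by (auto simp: free_on_def mla_iso_def mult_lie_algebra_free_mla)
qed

text \<open>\<open>K\<close> is presented by the free multiplicative Lie algebra on its own carrier.\<close>

theorem free_presentation_exists:
  fixes K :: "'k mla"
  assumes "mult_lie_algebra K"
  shows "\<exists>(R :: 'k mla_term set mla) j (F :: 'k mla_term set mla) \<pi>. free_presentation R j F \<pi> K"
proof -
  let ?X = "carrier K"
  let ?F = "free_mla ?X"
  interpret K: mult_lie_algebra K by (rule assms)
  interpret F: mult_lie_algebra ?F by (rule mult_lie_algebra_free_mla)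
  obtain \<pi> where \<pi>: "\<pi> \<in> mla_hom ?F K" "\<forall>x \<in> ?X. \<pi> (mla_class ?X (Gen x)) = x"
    using K.free_mla_universal[of "\<lambda>x. x" ?X] by auto
  interpret \<pi>: group_hom ?F K \<pi>
    using \<pi> by (simp add: group_hom_def group_hom_axioms_def mla_hom_def F.is_group K.is_group)
  have surj: "\<pi> ` carrier ?F = carrier K"
    using \<pi>(2) mla_class_in[of "Gen _" ?X] by (force simp: image_iff)
  let ?R = "?F\<lparr>carrier := kernel ?F K \<pi>\<rparr>"
  have sub: "subgroup (kernel ?F K \<pi>) ?F" by (rule \<pi>.subgroup_kernel)
  have kF: "x \<in> carrier ?F" if "x \<in> kernel ?F K \<pi>" for x
    using that by (simp add: kernel_def)
  have inv_eq: "inv\<^bsub>?R\<^esub> x = inv\<^bsub>?F\<^esub> x" if "x \<in> kernel ?F K \<pi>" for x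
    using F.m_inv_consistent[OF sub that] .
  have conj_eq: "conj_by ?R z x = conj_by ?F z x" if "z \<in> kernel ?F K \<pi>" for z x
    using inv_eq[OF that] by (simp add: conj_by_def)
  have star_in: "x \<star>\<^bsub>?F\<^esub> y \<in> kernel ?F K \<pi>" if "x \<in> kernel ?F K \<pi>" "y \<in> kernel ?F K \<pi>" for x y
    using that \<pi>(1) K.star_self[of "\<one>\<^bsub>K\<^esub>"] by (auto simp: kernel_def mla_hom_def)
  have "mult_lie_algebra ?R"
  proof (intro mult_lie_algebra.intro mult_lie_algebra_axioms.intro)
    show "group ?R" by (rule F.subgroup_imp_group[OF sub])
  qed (simp_all add: conj_eq star_in kF F.star_self F.star_mult_left F.star_mult_right
      F.star_jacobi F.conj_by_star)
  moreover have "(\<lambda>x. x) \<in> mla_hom ?R ?F"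
    by (auto simp: mla_hom_def hom_def kF)
  ultimately have "mla_short_exact ?R (\<lambda>x. x) ?F \<pi> K"
    using \<pi>(1) surj assms mult_lie_algebra_free_mla by (auto simp: mla_short_exact_def)
  then show ?thesis
    using free_on_free_mla unfolding free_presentation_def is_free_mla_def by blast
qed

end

theory Submission
  imports Defs "HOL-Algebra.Zassenhaus"
begin

text \<open>
  The hypotheses on \<open>K\<close> force every central extension of \<open>K\<close> to be a direct product, and in a
  direct product \<open>\<alpha>\<close> and \<open>\<eta>\<close> can be applied to the two factors separately.

  For the splitting, let \<open>N\<close> be the kernel of \<open>\<pi>\<close> and \<open>D = [F,F](F \<star> F)\<close>.  As \<open>F\<close> is free, \<open>\<pi>\<close> lifts
  through \<open>\<beta>\<close> to a homomorphism \<open>f : F \<rightarrow> G\<close> (lemma \<open>free_mla_lifting\<close>).  It maps \<open>N\<close> into the kernel of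
  \<open>\<beta>\<close>, which is central for both operations, so \<open>f\<close> kills \<open>[N,F](N \<star> F)\<close>.  Triviality of the Schur
  multiplier says that \<open>D \<inter> N\<close> lies in this subgroup; hence on \<open>D\<close> the value of \<open>f\<close> depends only on
  the value of \<open>\<pi>\<close>.  Because \<open>K\<close> is perfect, \<open>\<pi>\<close> maps \<open>D\<close> onto \<open>K\<close>, and so \<open>f\<close> restricted to \<open>D\<close>
  descends to a homomorphic section \<open>s : K \<rightarrow> G\<close> of \<open>\<beta>\<close> (theorem \<open>central_extension_splits\<close>).

  Given \<open>s\<close>, every element of \<open>G\<close> is uniquely of the form \<open>i h \<otimes> s k\<close>.  Products of such elements are
  computed componentwise, and \<open>\<star>\<close> ignores the central factors, so that
  \<open>i h \<otimes> s k \<mapsto> i (\<alpha> h) \<otimes> s (\<eta> k)\<close> is an automorphism inducing \<open>(\<alpha>, \<eta>)\<close>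
  (theorem \<open>split_central_extension_inducible\<close>).
\<close>

section \<open>Homomorphisms and commutator subgroups\<close>

lemma mla_hom_imp_group_hom:
  assumes "mult_lie_algebra L" "mult_lie_algebra M" "h \<in> mla_hom L M"
  shows "group_hom L M h"
  using assms by (auto simp: group_hom_def group_hom_axioms_def mla_hom_def mult_lie_algebra_def)

lemma mla_hom_star:
  assumes "h \<in> mla_hom L M" "x \<in> carrier L" "y \<in> carrier L"
  shows "h (x \<star>\<^bsub>L\<^esub> y) = h x \<star>\<^bsub>M\<^esub> h y"
  using assms by (simp add: mla_hom_def)

lemma (in mult_lie_algebra) commutator_subgroup_is_subgroup:
  assumes "A \<subseteq> carrier L" "B \<subseteq> carrier L"
  shows "subgroup (commutator_subgroup L A B) L"
  using assms unfolding commutator_subgroup_def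
  by (intro generate_is_subgroup) (auto simp: subset_iff)

lemma (in mult_lie_algebra) star_subgroup_is_subgroup:
  assumes "A \<subseteq> carrier L" "B \<subseteq> carrier L"
  shows "subgroup (star_subgroup L A B) L"
  using assms unfolding star_subgroup_def
  by (intro generate_is_subgroup) auto

lemma image_of_binary_comprehension:
  assumes "\<And>a b. a \<in> A \<Longrightarrow> b \<in> B \<Longrightarrow> h (f a b) = g (h a) (h b)"
  shows "h ` {f a b | a b. a \<in> A \<and> b \<in> B} = {g a b | a b. a \<in> h ` A \<and> b \<in> h ` B}"
proof (intro equalityI subsetI)
  fix y assume "y \<in> h ` {f a b | a b. a \<in> A \<and> b \<in> B}"
  then obtain a b where "a \<in> A" "b \<in> B" "y = h (f a b)" by blast
  then show "y \<in> {g a b | a b. a \<in> h ` A \<and> b \<in> h ` B}"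
    using assms by blast
next
  fix y assume "y \<in> {g a b | a b. a \<in> h ` A \<and> b \<in> h ` B}"
  then obtain a b where ab: "a \<in> A" "b \<in> B" "y = g (h a) (h b)" by blast
  then have "y = h (f a b)"
    using assms by simp
  with ab show "y \<in> h ` {f a b | a b. a \<in> A \<and> b \<in> B}"
    by blast
qed

text \<open>
  Homomorphisms carry generators of \<open>[A,B]\<close> and \<open>A \<star> B\<close> to generators.  Applied to \<open>\<pi>\<close> this turns
  perfectness of \<open>K\<close> into surjectivity on \<open>[F,F](F \<star> F)\<close>; applied to a lift of \<open>\<pi>\<close> it shows that
  \<open>[N,F](N \<star> F)\<close> is killed.
\<close>

lemma lie_commutator_image:
  assumes L: "mult_lie_algebra L" and M: "mult_lie_algebra M" and h: "h \<in> mla_hom L M"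
    and A: "A \<subseteq> carrier L" and B: "B \<subseteq> carrier L"
  shows "h ` lie_commutator L A B = lie_commutator M (h ` A) (h ` B)"
proof -
  interpret L: mult_lie_algebra L by (rule L)
  interpret h: group_hom L M h by (rule mla_hom_imp_group_hom[OF L M h])
  let ?C = "{a \<otimes>\<^bsub>L\<^esub> b \<otimes>\<^bsub>L\<^esub> inv\<^bsub>L\<^esub> a \<otimes>\<^bsub>L\<^esub> inv\<^bsub>L\<^esub> b | a b. a \<in> A \<and> b \<in> B}"
  let ?S = "{a \<star>\<^bsub>L\<^esub> b | a b. a \<in> A \<and> b \<in> B}"
  have "h (a \<otimes>\<^bsub>L\<^esub> b \<otimes>\<^bsub>L\<^esub> inv\<^bsub>L\<^esub> a \<otimes>\<^bsub>L\<^esub> inv\<^bsub>L\<^esub> b) =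
      h a \<otimes>\<^bsub>M\<^esub> h b \<otimes>\<^bsub>M\<^esub> inv\<^bsub>M\<^esub> h a \<otimes>\<^bsub>M\<^esub> inv\<^bsub>M\<^esub> h b"
    if "a \<in> A" "b \<in> B" for a b
    using that A B by (simp add: subset_iff)
  then have "h ` ?C =
      {a \<otimes>\<^bsub>M\<^esub> b \<otimes>\<^bsub>M\<^esub> inv\<^bsub>M\<^esub> a \<otimes>\<^bsub>M\<^esub> inv\<^bsub>M\<^esub> b | a b. a \<in> h ` A \<and> b \<in> h ` B}"
    by (rule image_of_binary_comprehension[where
          f = "\<lambda>a b. a \<otimes>\<^bsub>L\<^esub> b \<otimes>\<^bsub>L\<^esub> inv\<^bsub>L\<^esub> a \<otimes>\<^bsub>L\<^esub> inv\<^bsub>L\<^esub> b" and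
          g = "\<lambda>a b. a \<otimes>\<^bsub>M\<^esub> b \<otimes>\<^bsub>M\<^esub> inv\<^bsub>M\<^esub> a \<otimes>\<^bsub>M\<^esub> inv\<^bsub>M\<^esub> b"])
  moreover have "?C \<subseteq> carrier L"
    using A B by (auto simp: subset_iff)
  ultimately have C: "h ` commutator_subgroup L A B = commutator_subgroup M (h ` A) (h ` B)"
    unfolding commutator_subgroup_def using h.generate_img[of ?C] by (simp only:)
  have "h (a \<star>\<^bsub>L\<^esub> b) = h a \<star>\<^bsub>M\<^esub> h b" if "a \<in> A" "b \<in> B" for a b
    using that A B mla_hom_star[OF h] by auto
  then have "h ` ?S = {a \<star>\<^bsub>M\<^esub> b | a b. a \<in> h ` A \<and> b \<in> h ` B}"
    by (rule image_of_binary_comprehension[where f = "(\<star>\<^bsub>L\<^esub>)" and g = "(\<star>\<^bsub>M\<^esub>)"])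
  moreover have "?S \<subseteq> carrier L"
    using A B by auto
  ultimately have S: "h ` star_subgroup L A B = star_subgroup M (h ` A) (h ` B)"
    unfolding star_subgroup_def using h.generate_img[of ?S] by (simp only:)
  show ?thesis
    unfolding lie_commutator_def
    using set_mult_hom[OF h.homh L.commutator_subgroup_is_subgroup[OF A B, THEN subgroup.subset]
        L.star_subgroup_is_subgroup[OF A B, THEN subgroup.subset]] C S
    by simp
qed

context mult_lie_algebra
begin

lemma one_in_lie_commutator:
  assumes "A \<subseteq> carrier L" "B \<subseteq> carrier L"
  shows "\<one> \<in> lie_commutator L A B"
  using commutator_subgroup_is_subgroup[OF assms, THEN subgroup.one_closed]
    star_subgroup_is_subgroup[OF assms, THEN subgroup.one_closed]
  unfolding lie_commutator_def set_mult_def by force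

text \<open>Conjugation is an automorphism of \<open>\<star>\<close>, so it permutes the generators.\<close>

lemma star_subgroup_carrier_normal: "star_subgroup L (carrier L) (carrier L) \<lhd> L"
  unfolding star_subgroup_def
proof (rule normal_generateI)
  fix s g
  assume "s \<in> {a \<star> b | a b. a \<in> carrier L \<and> b \<in> carrier L}" and g: "g \<in> carrier L"
  then obtain a b where ab: "s = a \<star> b" "a \<in> carrier L" "b \<in> carrier L" by blast
  then have "g \<otimes> s \<otimes> inv g = conj_by L g a \<star> conj_by L g b"
    using g conj_by_star[of a b g] by (simp add: conj_by_def)
  then show "g \<otimes> s \<otimes> inv g \<in> {a \<star> b | a b. a \<in> carrier L \<and> b \<in> carrier L}"
    using g ab by (auto simp: conj_by_def)
qed auto

lemma lie_commutator_carrier_subgroup: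
  "subgroup (lie_commutator L (carrier L) (carrier L)) L"
  unfolding lie_commutator_def
  using mult_norm_subgroup[OF star_subgroup_carrier_normal
      commutator_subgroup_is_subgroup[OF subset_refl subset_refl]]
    commut_normal[OF commutator_subgroup_is_subgroup[OF subset_refl subset_refl]
      star_subgroup_carrier_normal]
  by simp

lemma star_in_lie_commutator:
  assumes "x \<in> carrier L" "y \<in> carrier L"
  shows "x \<star> y \<in> lie_commutator L (carrier L) (carrier L)"
proof -
  have "x \<star> y \<in> star_subgroup L (carrier L) (carrier L)"
    unfolding star_subgroup_def using assms by (intro generate.incl) blast
  moreover have "\<one> \<in> commutator_subgroup L (carrier L) (carrier L)"
    by (rule subgroup.one_closed[OF commutator_subgroup_is_subgroup]) auto
  moreover have "x \<star> y = \<one> \<otimes> (x \<star> y)"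
    using assms by simp
  ultimately show ?thesis
    unfolding lie_commutator_def set_mult_def by blast
qed

section \<open>Central elements\<close>

lemma lie_commutator_central:
  assumes A: "A \<subseteq> group_center L \<inter> lie_center L" and B: "B \<subseteq> carrier L"
  shows "lie_commutator L A B \<subseteq> {\<one>}"
proof -
  have "a \<otimes> b \<otimes> inv a \<otimes> inv b = \<one>" if "a \<in> A" "b \<in> B" for a b
  proof -
    have ab: "a \<in> carrier L" "b \<in> carrier L" "a \<otimes> b = b \<otimes> a"
      using that A B by (auto simp: group_center_def)
    then show ?thesis
      by (simp add: m_assoc)
  qed
  then have "{a \<otimes> b \<otimes> inv a \<otimes> inv b | a b. a \<in> A \<and> b \<in> B} \<subseteq> {\<one>}"
    by blast
  then have "commutator_subgroup L A B \<subseteq> {\<one>}"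
    unfolding commutator_subgroup_def by (rule generate_subgroup_incl[OF _ triv_subgroup])
  moreover have "{a \<star> b | a b. a \<in> A \<and> b \<in> B} \<subseteq> {\<one>}"
    using A B by (auto simp: lie_center_def)
  then have "star_subgroup L A B \<subseteq> {\<one>}"
    unfolding star_subgroup_def by (rule generate_subgroup_incl[OF _ triv_subgroup])
  ultimately have "lie_commutator L A B \<subseteq> {\<one>} <#> {\<one>}"
    unfolding lie_commutator_def by (rule mono_set_mult)
  then show ?thesis
    by (simp add: set_mult_def)
qed

text \<open>
  The Lie centre is defined by a condition on the left argument of \<open>\<star>\<close> only.  The condition on the
  right argument comes from expanding \<open>(c \<otimes> x) \<star> (c \<otimes> x) = \<one>\<close> by both distributive laws: all terms other
  than a conjugate of \<open>x \<star> c\<close> vanish.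
\<close>

lemma lie_center_star_right:
  assumes c: "c \<in> lie_center L" and x: "x \<in> carrier L"
  shows "x \<star> c = \<one>"
proof -
  have c': "c \<in> carrier L" "\<And>y. y \<in> carrier L \<Longrightarrow> c \<star> y = \<one>"
    using c by (auto simp: lie_center_def)
  have "x \<star> c = (x \<star> c) \<otimes> conj_by L c (x \<star> x)"
    using c' x by (simp add: conj_by_def star_self)
  also have "\<dots> = x \<star> (c \<otimes> x)"
    using c' x by (simp add: star_mult_right)
  also have "\<dots> = inv c \<otimes> conj_by L c (x \<star> (c \<otimes> x)) \<otimes> c"
    using c' x by (simp add: conj_by_def m_assoc inv_solve_left)
  also have "conj_by L c (x \<star> (c \<otimes> x)) = (c \<otimes> x) \<star> (c \<otimes> x)"
    using c' x by (simp add: star_mult_left[of c x] conj_by_def)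
  also have "\<dots> = \<one>"
    using c' x by (simp add: star_self)
  finally show ?thesis
    using c' by simp
qed

lemma star_mult_central:
  assumes c: "c \<in> group_center L \<inter> lie_center L" and d: "d \<in> group_center L \<inter> lie_center L"
    and x: "x \<in> carrier L" and y: "y \<in> carrier L"
  shows "(c \<otimes> x) \<star> (d \<otimes> y) = x \<star> y"
proof -
  have conj: "conj_by L z u = u" if "z \<in> group_center L" "u \<in> carrier L" for z u
    using that by (auto simp: conj_by_def group_center_def m_assoc)
  have cd: "c \<in> carrier L" "d \<in> carrier L"
    using c d by (auto simp: group_center_def)
  have "(c \<otimes> x) \<star> (d \<otimes> y) = x \<star> (d \<otimes> y)"
    using c x y cd by (simp add: star_mult_left conj) (simp add: lie_center_def)
  also have "\<dots> = x \<star> y"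
    using d x y cd by (simp add: star_mult_right conj lie_center_star_right)
  finally show ?thesis .
qed

end

section \<open>Projectivity of free multiplicative Lie algebras\<close>

text \<open>
  Choose preimages under \<open>\<beta>\<close> of the images of the free generators and extend by the universal
  property; uniqueness of extensions makes the triangle commute.  The universal property is that of
  the term algebra, so the extension is carried to \<open>F\<close> along the inverse of the isomorphism \<open>\<theta>\<close>.
\<close>

lemma free_mla_lifting:
  assumes F: "is_free_mla F" and G: "mult_lie_algebra G" and K: "mult_lie_algebra K"
    and \<beta>: "\<beta> \<in> mla_hom G K" "carrier K \<subseteq> \<beta> ` carrier G" and \<pi>: "\<pi> \<in> mla_hom F K"
  obtains f where "f \<in> mla_hom F G" "\<And>x. x \<in> carrier F \<Longrightarrow> \<beta> (f x) = \<pi> x"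
proof -
  obtain B \<theta> where B: "B \<subseteq> carrier F" "mult_lie_algebra F"
    and \<theta>: "\<theta> \<in> mla_iso (free_mla B) F" "\<And>b. b \<in> B \<Longrightarrow> \<theta> (mla_class B (Gen b)) = b"
    using F by (auto simp: is_free_mla_def free_on_def)
  let ?E = "free_mla B"
  interpret E: mult_lie_algebra ?E by (rule mult_lie_algebra_free_mla)
  interpret K: mult_lie_algebra K by (rule K)
  from \<theta> have \<theta>h: "\<theta> \<in> mla_hom ?E F" and bij: "bij_betw \<theta> (carrier ?E) (carrier F)"
    by (auto simp: mla_iso_def)
  define g where "g b = inv_into (carrier G) \<beta> (\<pi> b)" for b
  have g: "g b \<in> carrier G" "\<beta> (g b) = \<pi> b" if "b \<in> B" for b
  proof -
    have "\<pi> b \<in> \<beta> ` carrier G"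
      using that B \<pi> \<beta> by (auto simp: mla_hom_def hom_def Pi_iff subset_iff)
    then show "g b \<in> carrier G" "\<beta> (g b) = \<pi> b"
      unfolding g_def by (auto intro: inv_into_into f_inv_into_f)
  qed
  then obtain h where h: "h \<in> mla_hom ?E G" "\<And>b. b \<in> B \<Longrightarrow> h (mla_class B (Gen b)) = g b"
    using mult_lie_algebra.free_mla_universal[OF G, of g B] by blast
  have eq: "\<beta> (h A) = \<pi> (\<theta> A)" if "A \<in> carrier ?E" for A
    by (rule K.free_mla_universal_unique[OF mla_hom_compose[OF h(1) \<beta>(1)]
          mla_hom_compose[OF \<theta>h \<pi>] _ that])
      (simp add: h(2) \<theta>(2) g)
  let ?\<theta>' = "inv_into (carrier ?E) \<theta>"
  have inv: "?\<theta>' x \<in> carrier ?E" "\<theta> (?\<theta>' x) = x" if "x \<in> carrier F" for x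
    using that bij by (auto simp: bij_betw_def intro: inv_into_into f_inv_into_f)
  have left: "?\<theta>' (\<theta> A) = A" if "A \<in> carrier ?E" for A
    using that bij by (simp add: bij_betw_def)
  have "?\<theta>' \<in> mla_hom F ?E"
    unfolding mla_hom_def hom_def
  proof (intro CollectI conjI ballI Pi_I)
    fix x y assume xy: "x \<in> carrier F" "y \<in> carrier F"
    have "\<theta> (?\<theta>' x \<otimes>\<^bsub>?E\<^esub> ?\<theta>' y) = x \<otimes>\<^bsub>F\<^esub> y"
      using \<theta>h inv xy by (simp add: mla_hom_def hom_def)
    then show "?\<theta>' (x \<otimes>\<^bsub>F\<^esub> y) = ?\<theta>' x \<otimes>\<^bsub>?E\<^esub> ?\<theta>' y"
      using left inv xy by (metis E.m_closed)
    have "\<theta> (?\<theta>' x \<star>\<^bsub>?E\<^esub> ?\<theta>' y) = x \<star>\<^bsub>F\<^esub> y"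
      using mla_hom_star[OF \<theta>h] inv xy by simp
    then show "?\<theta>' (x \<star>\<^bsub>F\<^esub> y) = ?\<theta>' x \<star>\<^bsub>?E\<^esub> ?\<theta>' y"
      using left inv xy by (metis E.star_closed)
  qed (simp add: inv)
  from mla_hom_compose[OF this h(1)] have "(\<lambda>x. h (?\<theta>' x)) \<in> mla_hom F G" .
  moreover have "\<beta> (h (?\<theta>' x)) = \<pi> x" if "x \<in> carrier F" for x
    using eq inv that by simp
  ultimately show ?thesis
    by (rule that)
qed

section \<open>Splitting of central extensions\<close>

text \<open>
  If the coset of \<open>x\<close> is the subgroup \<open>[N,F](N \<star> F)\<close> itself, then \<open>x\<close> belongs to it, as
  it contains \<open>\<one>\<close>.
\<close>

lemma trivial_schur_multiplier_imp_subset: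
  assumes F: "mult_lie_algebra F" and N: "j ` carrier R \<subseteq> carrier F"
    and triv: "carrier (schur_multiplier R j F) = {\<one>\<^bsub>schur_multiplier R j F\<^esub>}"
  shows "lie_commutator F (carrier F) (carrier F) \<inter> j ` carrier R
           \<subseteq> lie_commutator F (j ` carrier R) (carrier F)"
proof
  interpret F: mult_lie_algebra F by (rule F)
  let ?D = "lie_commutator F (carrier F) (carrier F) \<inter> j ` carrier R"
  let ?I = "lie_commutator F (j ` carrier R) (carrier F)"
  fix x assume x: "x \<in> ?D"
  then have "?I #>\<^bsub>F\<^esub> x \<in> carrier (schur_multiplier R j F)"
    by (auto simp: schur_multiplier_def mla_quotient_def RCOSETS_def r_coset_def Let_def)
  then have "?I #>\<^bsub>F\<^esub> x = ?I"
    unfolding triv by (simp add: schur_multiplier_def mla_quotient_def Let_def)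
  moreover have "\<one>\<^bsub>F\<^esub> \<otimes>\<^bsub>F\<^esub> x \<in> ?I #>\<^bsub>F\<^esub> x"
    using F.one_in_lie_commutator[OF N subset_refl] by (auto simp: r_coset_def)
  ultimately show "x \<in> ?I"
    using x N by auto
qed

text \<open>
  The section sends \<open>k\<close> to \<open>f d\<close> for any \<open>d \<in> [F,F](F \<star> F)\<close> over \<open>k\<close>.  Independence of \<open>d\<close> gives both
  homomorphism laws, since \<open>[F,F](F \<star> F)\<close> is closed under both operations.
\<close>

theorem central_extension_splits:
  assumes E: "central_extension H i G \<beta> K"
    and perf: "perfect_mla K"
    and P: "free_presentation R j F \<pi> K"
    and triv: "carrier (schur_multiplier R j F) = {\<one>\<^bsub>schur_multiplier R j F\<^esub>}"
  obtains s where "s \<in> mla_hom K G" "\<And>k. k \<in> carrier K \<Longrightarrow> \<beta> (s k) = k"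
proof -
  have G: "mult_lie_algebra G" and K: "mult_lie_algebra K"
    and \<beta>: "\<beta> \<in> mla_hom G K" "\<beta> ` carrier G = carrier K"
    and ker\<beta>: "kernel G K \<beta> \<subseteq> group_center G \<inter> lie_center G"
    using E by (auto simp: central_extension_def mla_short_exact_def)
  have F: "mult_lie_algebra F" "is_free_mla F"
    and \<pi>: "\<pi> \<in> mla_hom F K" "\<pi> ` carrier F = carrier K"
    and ker\<pi>: "j ` carrier R = kernel F K \<pi>"
    using P by (auto simp: free_presentation_def mla_short_exact_def)
  interpret G: mult_lie_algebra G by (rule G)
  interpret F: mult_lie_algebra F by (rule F)
  interpret \<pi>: group_hom F K \<pi> by (rule mla_hom_imp_group_hom[OF F(1) K \<pi>(1)])
  obtain f where f: "f \<in> mla_hom F G" "\<And>x. x \<in> carrier F \<Longrightarrow> \<beta> (f x) = \<pi> x"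
    using free_mla_lifting[OF F(2) G K \<beta>(1) _ \<pi>(1)] \<beta>(2) by blast
  interpret f: group_hom F G f by (rule mla_hom_imp_group_hom[OF F(1) G f(1)])
  let ?N = "kernel F K \<pi>"
  let ?D = "lie_commutator F (carrier F) (carrier F)"
  have N: "?N \<subseteq> carrier F"
    by (auto simp: kernel_def)
  have D: "subgroup ?D F"
    by (rule F.lie_commutator_carrier_subgroup)
  have \<pi>D: "\<pi> ` ?D = carrier K"
    using lie_commutator_image[OF F(1) K \<pi>(1) subset_refl subset_refl] \<pi>(2) perf
    by (simp add: perfect_mla_def)
  have fN: "f ` ?N \<subseteq> group_center G \<inter> lie_center G"
    using ker\<beta> f(2) by (force simp: kernel_def)
  have "f ` lie_commutator F ?N (carrier F) \<subseteq> {\<one>\<^bsub>G\<^esub>}"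
    unfolding lie_commutator_image[OF F(1) G f(1) N subset_refl]
    by (rule G.lie_commutator_central[OF fN]) auto
  then have fI: "f x = \<one>\<^bsub>G\<^esub>" if "x \<in> ?D \<inter> ?N" for x
    using trivial_schur_multiplier_imp_subset[of F j R] F(1) N triv that unfolding ker\<pi> by blast
  \<comment> \<open>On \<open>?D\<close> the lift factors through \<open>\<pi>\<close>: two preimages of one element differ by an element of
    \<open>?D \<inter> ?N\<close>.\<close>
  have f_cong: "f x = f y" if "x \<in> ?D" "y \<in> ?D" "\<pi> x = \<pi> y" for x y
  proof -
    have xy: "x \<in> carrier F" "y \<in> carrier F"
      using that subgroup.mem_carrier[OF D] by auto
    have "x \<otimes>\<^bsub>F\<^esub> inv\<^bsub>F\<^esub> y \<in> ?D"
      using that D by (simp add: subgroup.m_closed subgroup.m_inv_closed)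
    moreover have "x \<otimes>\<^bsub>F\<^esub> inv\<^bsub>F\<^esub> y \<in> ?N"
      using that xy by (simp add: kernel_def)
    ultimately have "f (x \<otimes>\<^bsub>F\<^esub> inv\<^bsub>F\<^esub> y) = \<one>\<^bsub>G\<^esub>"
      using fI by blast
    then have "f x \<otimes>\<^bsub>G\<^esub> inv\<^bsub>G\<^esub> f y = \<one>\<^bsub>G\<^esub>"
      using xy by simp
    then show ?thesis
      using xy by (metis G.inv_solve_right G.l_one G.one_closed f.hom_closed)
  qed
  define d where "d k = inv_into ?D \<pi> k" for k
  have d: "d k \<in> ?D" "\<pi> (d k) = k" if "k \<in> carrier K" for k
    using that \<pi>D by (auto simp: d_def intro: inv_into_into f_inv_into_f)
  have d': "d k \<in> carrier F" if "k \<in> carrier K" for k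
    using d(1)[OF that] by (rule subgroup.mem_carrier[OF D])
  show ?thesis
  proof (rule that)
    show "(\<lambda>k. f (d k)) \<in> mla_hom K G"
      unfolding mla_hom_def hom_def
    proof (intro CollectI conjI ballI Pi_I)
      fix k l assume kl: "k \<in> carrier K" "l \<in> carrier K"
      have "f (d (k \<otimes>\<^bsub>K\<^esub> l)) = f (d k \<otimes>\<^bsub>F\<^esub> d l)"
        by (rule f_cong) (use d d' kl in \<open>simp_all add: subgroup.m_closed[OF D]\<close>)
      then show "f (d (k \<otimes>\<^bsub>K\<^esub> l)) = f (d k) \<otimes>\<^bsub>G\<^esub> f (d l)"
        using d' kl by simp
      have "f (d (k \<star>\<^bsub>K\<^esub> l)) = f (d k \<star>\<^bsub>F\<^esub> d l)"
        by (rule f_cong) (use d d' kl in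
            \<open>simp_all add: F.star_in_lie_commutator mla_hom_star[OF \<pi>(1)]
              mult_lie_algebra.star_closed[OF K]\<close>)
      then show "f (d (k \<star>\<^bsub>K\<^esub> l)) = f (d k) \<star>\<^bsub>G\<^esub> f (d l)"
        using d' kl mla_hom_star[OF f(1)] by simp
    qed (use d' in auto)
    show "\<beta> (f (d k)) = k" if "k \<in> carrier K" for k
      using f(2) d d' that by simp
  qed
qed

section \<open>Automorphisms of split central extensions\<close>

text \<open>
  The automorphism is defined on \<open>x \<in> carrier G\<close> through its components: \<open>\<beta> x\<close>, and the element of \<open>H\<close>
  whose image is \<open>x \<otimes> inv (s (\<beta> x))\<close>.  It respects \<open>\<star>\<close>
  because \<open>(i h \<otimes> s k) \<star> (i h' \<otimes> s k') = s (k \<star> k')\<close>, the central factors being ignored by \<open>\<star>\<close>.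
\<close>

theorem split_central_extension_inducible:
  assumes E: "central_extension H i G \<beta> K"
    and s: "s \<in> mla_hom K G" "\<And>k. k \<in> carrier K \<Longrightarrow> \<beta> (s k) = k"
    and \<alpha>: "\<alpha> \<in> mla_auto H" and \<eta>: "\<eta> \<in> mla_auto K"
  shows "inducible H i G \<beta> K \<alpha> \<eta>"
proof -
  have H: "mult_lie_algebra H" and G: "mult_lie_algebra G" and K: "mult_lie_algebra K"
    and i: "i \<in> mla_hom H G" "inj_on i (carrier H)"
    and \<beta>: "\<beta> \<in> mla_hom G K" "\<beta> ` carrier G = carrier K"
    and ker: "i ` carrier H = kernel G K \<beta>"
    and central: "i ` carrier H \<subseteq> group_center G \<inter> lie_center G"
    using E by (auto simp: central_extension_def mla_short_exact_def)
  interpret H: mult_lie_algebra H by (rule H)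
  interpret G: mult_lie_algebra G by (rule G)
  interpret K: mult_lie_algebra K by (rule K)
  interpret i: group_hom H G i by (rule mla_hom_imp_group_hom[OF H G i(1)])
  interpret \<beta>: group_hom G K \<beta> by (rule mla_hom_imp_group_hom[OF G K \<beta>(1)])
  interpret s: group_hom K G s by (rule mla_hom_imp_group_hom[OF K G s(1)])
  have \<alpha>h: "\<alpha> \<in> mla_hom H H" and \<alpha>b: "bij_betw \<alpha> (carrier H) (carrier H)"
    and \<eta>h: "\<eta> \<in> mla_hom K K" and \<eta>b: "bij_betw \<eta> (carrier K) (carrier K)"
    using \<alpha> \<eta> by (auto simp: mla_auto_def Bij_def)
  interpret \<alpha>: group_hom H H \<alpha> by (rule mla_hom_imp_group_hom[OF H H \<alpha>h])
  interpret \<eta>: group_hom K K \<eta> by (rule mla_hom_imp_group_hom[OF K K \<eta>h])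

  have \<beta>i: "\<beta> (i h) = \<one>\<^bsub>K\<^esub>" if "h \<in> carrier H" for h
    using that ker by (auto simp: kernel_def)
  have ic: "i h \<in> group_center G \<inter> lie_center G" if "h \<in> carrier H" for h
    using that central by blast
  have i_comm: "i h \<otimes>\<^bsub>G\<^esub> x = x \<otimes>\<^bsub>G\<^esub> i h" if "h \<in> carrier H" "x \<in> carrier G" for h x
    using ic[OF that(1)] that(2) by (auto simp: group_center_def)

  have decomp: "\<exists>h \<in> carrier H. \<exists>k \<in> carrier K. x = i h \<otimes>\<^bsub>G\<^esub> s k" if "x \<in> carrier G" for x
  proof -
    have "x \<otimes>\<^bsub>G\<^esub> inv\<^bsub>G\<^esub> s (\<beta> x) \<in> kernel G K \<beta>"
      using that s(2) by (simp add: kernel_def)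
    then obtain h where "h \<in> carrier H" "i h = x \<otimes>\<^bsub>G\<^esub> inv\<^bsub>G\<^esub> s (\<beta> x)"
      using ker by (metis imageE)
    then show ?thesis
      using that by (intro bexI[of _ h] bexI[of _ "\<beta> x"]) (auto simp: G.m_assoc)
  qed
  have \<beta>_is: "\<beta> (i h \<otimes>\<^bsub>G\<^esub> s k) = k" if "h \<in> carrier H" "k \<in> carrier K" for h k
    using that s(2) \<beta>i by simp
  have unique: "h = h' \<and> k = k'"
    if "i h \<otimes>\<^bsub>G\<^esub> s k = i h' \<otimes>\<^bsub>G\<^esub> s k'"
      "h \<in> carrier H" "k \<in> carrier K" "h' \<in> carrier H" "k' \<in> carrier K" for h h' k k'
  proof -
    have "k = k'"
      using \<beta>_is that by metis
    moreover from this have "i h = i h'"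
      using that by simp
    ultimately show ?thesis
      using i(2) that by (auto dest: inj_onD)
  qed
  have mult: "(i h \<otimes>\<^bsub>G\<^esub> s k) \<otimes>\<^bsub>G\<^esub> (i h' \<otimes>\<^bsub>G\<^esub> s k') = i (h \<otimes>\<^bsub>H\<^esub> h') \<otimes>\<^bsub>G\<^esub> s (k \<otimes>\<^bsub>K\<^esub> k')"
    if "h \<in> carrier H" "k \<in> carrier K" "h' \<in> carrier H" "k' \<in> carrier K" for h h' k k'
  proof -
    have "s k \<otimes>\<^bsub>G\<^esub> (i h' \<otimes>\<^bsub>G\<^esub> s k') = i h' \<otimes>\<^bsub>G\<^esub> (s k \<otimes>\<^bsub>G\<^esub> s k')"
      using that i_comm[of h' "s k"] by (simp flip: G.m_assoc)
    then show ?thesis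
      using that by (simp add: G.m_assoc)
  qed
  \<comment> \<open>The factor \<open>i \<one>\<close> brings the result into the shape to which the formula for \<open>\<phi>\<close> below applies.\<close>
  have star: "(i h \<otimes>\<^bsub>G\<^esub> s k) \<star>\<^bsub>G\<^esub> (i h' \<otimes>\<^bsub>G\<^esub> s k') = i \<one>\<^bsub>H\<^esub> \<otimes>\<^bsub>G\<^esub> s (k \<star>\<^bsub>K\<^esub> k')"
    if "h \<in> carrier H" "k \<in> carrier K" "h' \<in> carrier H" "k' \<in> carrier K" for h h' k k'
    using that by (simp add: G.star_mult_central[OF ic ic] mla_hom_star[OF s(1)])

  define \<phi> where "\<phi> = (\<lambda>x \<in> carrier G.
    i (\<alpha> (inv_into (carrier H) i (x \<otimes>\<^bsub>G\<^esub> inv\<^bsub>G\<^esub> s (\<beta> x)))) \<otimes>\<^bsub>G\<^esub> s (\<eta> (\<beta> x)))"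
  have \<phi>: "\<phi> (i h \<otimes>\<^bsub>G\<^esub> s k) = i (\<alpha> h) \<otimes>\<^bsub>G\<^esub> s (\<eta> k)" if "h \<in> carrier H" "k \<in> carrier K" for h k
  proof -
    have "i h \<otimes>\<^bsub>G\<^esub> s k \<otimes>\<^bsub>G\<^esub> inv\<^bsub>G\<^esub> s k = i h"
      using that by (simp add: G.m_assoc)
    then show ?thesis
      using that i(2) by (simp add: \<phi>_def \<beta>_is del: \<beta>.hom_mult)
  qed
  have \<phi>_hom: "\<phi> \<in> mla_hom G G"
    unfolding mla_hom_def hom_def
  proof (intro CollectI conjI ballI Pi_I)
    fix x y assume "x \<in> carrier G" "y \<in> carrier G"
    then obtain h k h' k' where hk: "h \<in> carrier H" "k \<in> carrier K" "h' \<in> carrier H" "k' \<in> carrier K"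
      and x: "x = i h \<otimes>\<^bsub>G\<^esub> s k" and y: "y = i h' \<otimes>\<^bsub>G\<^esub> s k'"
      using decomp by metis
    show "\<phi> x \<in> carrier G"
      using hk by (simp add: x \<phi>)
    show "\<phi> (x \<otimes>\<^bsub>G\<^esub> y) = \<phi> x \<otimes>\<^bsub>G\<^esub> \<phi> y"
      unfolding x y using hk
      by (simp only: mult \<phi> H.m_closed K.m_closed \<alpha>.hom_closed \<eta>.hom_closed
          \<alpha>.hom_mult \<eta>.hom_mult)
    show "\<phi> (x \<star>\<^bsub>G\<^esub> y) = \<phi> x \<star>\<^bsub>G\<^esub> \<phi> y"
      unfolding x y using hk
      by (simp only: star \<phi> H.one_closed K.star_closed \<alpha>.hom_closed \<eta>.hom_closed
          \<alpha>.hom_one mla_hom_star[OF \<eta>h])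
  qed
  have "inj_on \<phi> (carrier G)"
  proof (rule inj_onI)
    fix x y assume xy: "x \<in> carrier G" "y \<in> carrier G" "\<phi> x = \<phi> y"
    then obtain h k h' k' where hk: "h \<in> carrier H" "k \<in> carrier K" "h' \<in> carrier H" "k' \<in> carrier K"
      and x: "x = i h \<otimes>\<^bsub>G\<^esub> s k" and y: "y = i h' \<otimes>\<^bsub>G\<^esub> s k'"
      using decomp by metis
    then have "\<alpha> h = \<alpha> h' \<and> \<eta> k = \<eta> k'"
      using xy(3) by (intro unique) (simp_all add: \<phi>)
    then show "x = y"
      using hk \<alpha>b \<eta>b unfolding x y bij_betw_def by (metis inj_onD)
  qed
  moreover have "\<phi> ` carrier G = carrier G"
  proof
    show "\<phi> ` carrier G \<subseteq> carrier G"
      using \<phi>_hom by (auto simp: mla_hom_def hom_def)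
    show "carrier G \<subseteq> \<phi> ` carrier G"
    proof
      fix x assume "x \<in> carrier G"
      then obtain h k where hk: "h \<in> carrier H" "k \<in> carrier K" "x = i h \<otimes>\<^bsub>G\<^esub> s k"
        using decomp by blast
      then obtain h' k' where "h' \<in> carrier H" "\<alpha> h' = h" "k' \<in> carrier K" "\<eta> k' = k"
        using \<alpha>b \<eta>b unfolding bij_betw_def by (metis imageE)
      then show "x \<in> \<phi> ` carrier G"
        using hk \<phi>[of h' k'] by (intro image_eqI[of _ _ "i h' \<otimes>\<^bsub>G\<^esub> s k'"]) auto
    qed
  qed
  ultimately have \<phi>_auto: "\<phi> \<in> mla_auto G"
    using \<phi>_hom by (simp add: mla_auto_def Bij_def bij_betw_def) (simp add: \<phi>_def)
  have \<phi>_i: "\<phi> (i h) = i (\<alpha> h)" if "h \<in> carrier H" for h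
    using \<phi>[OF that K.one_closed] that by simp
  have "\<phi> ` i ` carrier H = i ` \<alpha> ` carrier H"
    using \<phi>_i by (simp add: image_image)
  then have \<phi>_H: "\<phi> ` i ` carrier H = i ` carrier H"
    using \<alpha>b by (simp add: bij_betw_def)
  have "\<beta> (\<phi> x) = \<eta> (\<beta> x)" if "x \<in> carrier G" for x
    using decomp[OF that] \<phi> \<beta>_is by (metis \<alpha>.hom_closed \<eta>.hom_closed)
  then have "\<forall>t \<in> transversals G \<beta> K. \<forall>x \<in> carrier K. \<beta> (\<phi> (t x)) = \<eta> x"
    by (auto simp: transversals_def Pi_iff)
  with \<phi>_auto \<phi>_H \<phi>_i show ?thesis
    unfolding inducible_def by blast
qed

section \<open>Perfect algebras with trivial Schur multiplier\<close>

theorem corollary3p13: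
  fixes H :: "'h mla" and G :: "'g mla" and K :: "'k mla"
    and R :: "'r mla" and F :: "'f mla"
    and i :: "'h \<Rightarrow> 'g" and \<beta> :: "'g \<Rightarrow> 'k" and j :: "'r \<Rightarrow> 'f" and \<pi> :: "'f \<Rightarrow> 'k"
  assumes "central_extension H i G \<beta> K"
    and "finite (carrier K)"
    and "perfect_mla K"
    and "free_presentation R j F \<pi> K"
    and "carrier (schur_multiplier R j F) = {\<one>\<^bsub>schur_multiplier R j F\<^esub>}"
  shows "\<forall>\<alpha> \<in> mla_auto H. \<forall>\<eta> \<in> mla_auto K. inducible H i G \<beta> K \<alpha> \<eta>"
proof -
  obtain s where "s \<in> mla_hom K G" "\<And>k. k \<in> carrier K \<Longrightarrow> \<beta> (s k) = k"
    using central_extension_splits[OF assms(1,3-5)] by blast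
  then show ?thesis
    using split_central_extension_inducible[OF assms(1)] by blast
qed

end
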